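(* Let $\gamma\in(2,3)$ and let $\mathcal{C}$ be a collection of $O(n)$ co-occurrence sets on a set $V$ of $n$ nodes, each generated independently by the power-law co-occurrence model with exponent $\gamma$. Then the expected co-occurrence degree of each node $v\in V$ is $O(1)$, and $\mathbb{E}\big[\sum_{c\in\mathcal{C}}|c|^2\big]=O(n^{4-\gamma})$.
   Context: Power-law co-occurrence model: a set $c$ is generated by drawing a size $K\in\{1,\dots,n\}$ with $\mathbb{P}[K=k]=Ck^{-\gamma}$, where $C$ is the normalizing constant, and then choosing $c$ as a uniformly random $K$-element subset of $V$; sizes are drawn independently for different sets. The co-occurrence degree of $v$ is the number of sets $c\in\mathcal{C}$ containing $v$. Asymptotics are as $n\to\infty$. *)

theory Defs
  imports "HOL-Probability.Probability" "HOL-Library.Landau_Symbols"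
begin

definition size_norm :: "nat \<Rightarrow> real \<Rightarrow> real" where
  "size_norm n \<gamma> = 1 / (\<Sum>k=1..n. real k powr (-\<gamma>))"

(* Only meaningful for n \<ge> 1: there is no distribution on the empty range {1..0}. *)
definition cooc_size_pmf :: "nat \<Rightarrow> real \<Rightarrow> nat pmf" where
  "cooc_size_pmf n \<gamma> =
     embed_pmf (\<lambda>k. if k \<in> {1..n} then size_norm n \<gamma> * real k powr (-\<gamma>) else 0)"

definition cooc_set_pmf :: "'a set \<Rightarrow> real \<Rightarrow> 'a set pmf" where
  "cooc_set_pmf V \<gamma> =
     bind_pmf (cooc_size_pmf (card V) \<gamma>) (\<lambda>k. pmf_of_set {c. c \<subseteq> V \<and> card c = k})"

(* The collection is an indexed family c 0, ..., c (m - 1), so a set that is drawn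
   repeatedly counts with multiplicity. The value {} outside the index range is the
   dummy required by Pi_pmf. *)
definition cooc_family_pmf :: "nat \<Rightarrow> 'a set \<Rightarrow> real \<Rightarrow> (nat \<Rightarrow> 'a set) pmf" where
  "cooc_family_pmf m V \<gamma> = Pi_pmf {..<m} {} (\<lambda>_. cooc_set_pmf V \<gamma>)"

definition cooc_degree :: "nat \<Rightarrow> (nat \<Rightarrow> 'a set) \<Rightarrow> 'a \<Rightarrow> nat" where
  "cooc_degree m c v = card {i. i < m \<and> v \<in> c i}"

lemma pmf_cooc_size_pmf:
  assumes "n \<ge> 1"
  shows "pmf (cooc_size_pmf n \<gamma>) k =
           (if k \<in> {1..n} then size_norm n \<gamma> * real k powr (-\<gamma>) else 0)"
proof -
  let ?f = "\<lambda>k. if k \<in> {1..n} then size_norm n \<gamma> * real k powr (-\<gamma>) else 0"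
  have pos: "(\<Sum>k=1..n. real k powr (-\<gamma>)) > 0"
    using assms by (intro sum_pos) auto
  have nonneg: "?f k \<ge> 0" for k
    using pos by (auto simp: size_norm_def)
  have "(\<integral>\<^sup>+k. ennreal (?f k) \<partial>count_space UNIV) = (\<Sum>k\<in>{1..n}. ennreal (?f k))"
    by (intro nn_integral_count_space') (auto simp: nonneg)
  also have "\<dots> = ennreal (\<Sum>k\<in>{1..n}. ?f k)"
    by (rule sum_ennreal) (rule nonneg)
  also have "(\<Sum>k\<in>{1..n}. ?f k) = (\<Sum>k=1..n. size_norm n \<gamma> * real k powr (-\<gamma>))"
    by (intro sum.cong) auto
  also have "\<dots> = 1"
    using pos by (simp add: size_norm_def flip: sum_divide_distrib)
  finally have "(\<integral>\<^sup>+k. ennreal (?f k) \<partial>count_space UNIV) = 1" by simp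
  then show ?thesis
    unfolding cooc_size_pmf_def by (intro pmf_embed_pmf nonneg)
qed

lemma set_cooc_set_pmf:
  assumes "finite V" "V \<noteq> {}"
  shows "set_pmf (cooc_set_pmf V \<gamma>) \<subseteq> {c. c \<subseteq> V \<and> c \<noteq> {}}"
proof
  fix c assume "c \<in> set_pmf (cooc_set_pmf V \<gamma>)"
  then obtain k where k: "k \<in> set_pmf (cooc_size_pmf (card V) \<gamma>)"
    and c: "c \<in> set_pmf (pmf_of_set {c. c \<subseteq> V \<and> card c = k})"
    by (auto simp: cooc_set_pmf_def)
  have "card V \<ge> 1" using assms by (simp add: Suc_le_eq card_gt_0_iff)
  then have kr: "1 \<le> k" "k \<le> card V"
    using k by (auto simp: set_pmf_iff pmf_cooc_size_pmf split: if_splits)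
  have "{c. c \<subseteq> V \<and> card c = k} \<noteq> {}"
    using obtain_subset_with_card_n[OF kr(2)] by blast
  then have "c \<subseteq> V \<and> card c = k"
    using c assms(1) by (subst (asm) set_pmf_of_set) auto
  then show "c \<in> {c. c \<subseteq> V \<and> c \<noteq> {}}" using kr by auto
qed

(* Hence all expectations under this distribution are finite sums. *)
lemma finite_set_cooc_family_pmf:
  assumes "finite V" "V \<noteq> {}"
  shows "finite (set_pmf (cooc_family_pmf m V \<gamma>))"
proof -
  have "finite (set_pmf (cooc_set_pmf V \<gamma>))"
    by (rule finite_subset[OF set_cooc_set_pmf[OF assms]]) (use assms in auto)
  then show ?thesis
    unfolding cooc_family_pmf_def by (subst set_Pi_pmf) (auto intro!: finite_PiE_dflt)
qed

end

theory Submission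
  imports Defs
begin

text \<open>Both quantities are sums over the sets of the collection, so linearity of expectation reduces
  them to a single random set of size \<open>K\<close>, which contains a given node with probability \<open>E[K] / n\<close>.
  For \<open>2 < \<gamma> < 3\<close> the first moment of \<open>K\<close> is bounded by the convergent series
  \<open>\<Sum>k. k powr (1 - \<gamma>)\<close>, and the second by \<open>\<Sum>k\<le>n. k powr (2 - \<gamma>)\<close>, which is at most
  \<open>n powr (3 - \<gamma>) / (3 - \<gamma>)\<close>.\<close>

text \<open>Comparison with the integral of \<open>x powr (p - 1)\<close>, done by telescoping: the
  exponent \<open>p - 1\<close> is negative, so each summand is at most the increment of
  \<open>x powr p / p\<close> over the unit interval ending at \<open>k\<close>.\<close>

lemma sum_powr_le:
  fixes p :: real
  assumes "0 < p" "p < 1"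
  shows "(\<Sum>k=1..n. real k powr (p - 1)) \<le> real n powr p / p"
proof (induction n)
  case 0
  then show ?case using assms by simp
next
  case (Suc n)
  have step: "real (Suc n) powr (p - 1) \<le> (real (Suc n) powr p - real n powr p) / p"
  proof (cases "n = 0")
    case True
    then show ?thesis using assms by (simp add: field_simps)
  next
    case False
    have "\<exists>z. real n < z \<and> z < real (Suc n) \<and>
        real (Suc n) powr p - real n powr p = (real (Suc n) - real n) * (p * z powr (p - 1))"
      using False by (intro MVT2) (auto intro!: derivative_eq_intros simp: powr_diff)
    then obtain z where z: "real n < z" "z < real (Suc n)"
      "real (Suc n) powr p - real n powr p = p * z powr (p - 1)" by auto
    have "real (Suc n) powr (p - 1) \<le> z powr (p - 1)"
      using z False assms by (intro powr_mono2') auto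
    then show ?thesis using z(3) assms by (simp add: field_simps)
  qed
  have "(\<Sum>k=1..Suc n. real k powr (p - 1)) =
      (\<Sum>k=1..n. real k powr (p - 1)) + real (Suc n) powr (p - 1)"
    by simp
  also have "\<dots> \<le> real n powr p / p + (real (Suc n) powr p - real n powr p) / p"
    using Suc.IH step by (rule add_mono)
  also have "\<dots> = real (Suc n) powr p / p"
    by (simp add: diff_divide_distrib)
  finally show ?case .
qed

lemma size_norm_nonneg: "size_norm n \<gamma> \<ge> 0"
  by (simp add: size_norm_def sum_nonneg)

text \<open>The term \<open>k = 1\<close> alone contributes 1 to the normalizing sum, and for
  \<open>n = 0\<close> the value is \<open>1 / 0 = 0\<close>. Hence bounds on the unnormalized
  moments suffice later.\<close>

lemma size_norm_le_1: "size_norm n \<gamma> \<le> 1"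
proof (cases "n = 0")
  case True
  then show ?thesis by (simp add: size_norm_def)
next
  case False
  have "(\<Sum>k\<in>{1}. real k powr (-\<gamma>)) \<le> (\<Sum>k=1..n. real k powr (-\<gamma>))"
    using False by (intro sum_mono2) auto
  then show ?thesis by (simp add: size_norm_def)
qed

text \<open>Law of total expectation, conditioning on the size; \<open>h k\<close> is the
  conditional mean of \<open>g\<close> given size \<open>k\<close>, required only for sizes in the
  support.\<close>

lemma expectation_cooc_set_pmf:
  fixes g :: "'a set \<Rightarrow> real"
  assumes "finite V" "V \<noteq> {}"
    and "\<And>k. 1 \<le> k \<Longrightarrow> k \<le> card V \<Longrightarrow>
      measure_pmf.expectation (pmf_of_set {c. c \<subseteq> V \<and> card c = k}) g = h k"
  shows "measure_pmf.expectation (cooc_set_pmf V \<gamma>) g =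
    (\<Sum>k=1..card V. size_norm (card V) \<gamma> * real k powr (-\<gamma>) * h k)"
proof -
  have n: "card V \<ge> 1"
    using assms(1,2) by (simp add: Suc_le_eq card_gt_0_iff)
  \<comment> \<open>The support of \<open>pmf_of_set\<close> is known only for finite nonempty sets;
    here it yields the finite supports that \<open>pmf_expectation_bind\<close> asks for.\<close>
  have nonempty: "{c. c \<subseteq> V \<and> card c = k} \<noteq> {}" if "k \<le> card V" for k
    using obtain_subset_with_card_n[OF that] by blast
  have "measure_pmf.expectation (cooc_set_pmf V \<gamma>) g =
      (\<Sum>k\<in>{1..card V}. pmf (cooc_size_pmf (card V) \<gamma>) k *\<^sub>R
         measure_pmf.expectation (pmf_of_set {c. c \<subseteq> V \<and> card c = k}) g)"
    unfolding cooc_set_pmf_def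
    using assms(1) n nonempty
    by (intro pmf_expectation_bind)
       (auto simp: set_pmf_iff pmf_cooc_size_pmf split: if_splits)
  also have "\<dots> = (\<Sum>k=1..card V. size_norm (card V) \<gamma> * real k powr (-\<gamma>) * h k)"
    using n assms(3) by (intro sum.cong) (auto simp: pmf_cooc_size_pmf)
  finally show ?thesis .
qed

text \<open>Linearity of expectation: every coordinate of the product has marginal
  \<open>cooc_set_pmf V \<gamma>\<close>, and finite support gives integrability.\<close>

lemma expectation_cooc_family_sum:
  fixes g :: "'a set \<Rightarrow> real"
  assumes "finite V" "V \<noteq> {}"
  shows "measure_pmf.expectation (cooc_family_pmf m V \<gamma>) (\<lambda>c. \<Sum>i<m. g (c i)) =
    real m * measure_pmf.expectation (cooc_set_pmf V \<gamma>) g"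
proof -
  have "measure_pmf.expectation (cooc_family_pmf m V \<gamma>) (\<lambda>c. g (c i)) =
      measure_pmf.expectation (cooc_set_pmf V \<gamma>) g" if "i < m" for i
  proof -
    have "map_pmf (\<lambda>c. c i) (cooc_family_pmf m V \<gamma>) = cooc_set_pmf V \<gamma>"
      unfolding cooc_family_pmf_def using that by (subst Pi_pmf_component) auto
    then show ?thesis by (metis integral_map_pmf)
  qed
  then show ?thesis
    using finite_set_cooc_family_pmf[OF assms]
    by (subst Bochner_Integration.integral_sum) (auto intro: integrable_measure_pmf_finite)
qed

lemma prob_mem_uniform_subset:
  assumes "finite V" "v \<in> V" "1 \<le> k" "k \<le> card V"
  shows "measure_pmf.expectation (pmf_of_set {c. c \<subseteq> V \<and> card c = k}) (\<lambda>c. of_bool (v \<in> c)) =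
    real k / real (card V)"
proof -
  let ?S = "{c. c \<subseteq> V \<and> card c = k}"
  have fin: "finite ?S" using assms(1) by simp
  have cardS: "card ?S = card V choose k" using n_subsets[OF assms(1)] .
  have pos: "card V choose k > 0" using assms(4) by simp
  have ne: "?S \<noteq> {}" using pos cardS by (metis card.empty less_irrefl)
  \<comment> \<open>Deleting \<open>v\<close> matches the \<open>k\<close>-subsets containing
    \<open>v\<close> with the \<open>(k - 1)\<close>-subsets of the remaining nodes;
    \<open>1 \<le> k\<close> keeps the natural subtraction exact.\<close>
  have "?S \<inter> {c. v \<in> c} = insert v ` {c. c \<subseteq> V - {v} \<and> card c = k - 1}" (is "_ = _ ` ?T")
  proof (intro equalityI subsetI)
    fix c assume c: "c \<in> ?S \<inter> {c. v \<in> c}"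
    then have "finite c" using assms(1) finite_subset by blast
    then have "c - {v} \<in> ?T" using c by auto
    moreover have "c = insert v (c - {v})" using c by auto
    ultimately show "c \<in> insert v ` ?T" by blast
  next
    fix c assume "c \<in> insert v ` ?T"
    then obtain d where d: "d \<subseteq> V - {v}" "card d = k - 1" "c = insert v d" by auto
    then have "finite d" using assms(1) by (meson finite_Diff finite_subset)
    moreover have "v \<notin> d" using d by auto
    ultimately show "c \<in> ?S \<inter> {c. v \<in> c}" using d assms(2,3) by auto
  qed
  moreover have "inj_on (insert v) ?T"
    by (rule inj_onI) blast
  ultimately have "card (?S \<inter> {c. v \<in> c}) = card ?T"
    by (simp add: card_image)
  also have "\<dots> = (card V - 1) choose (k - 1)"
    using assms(1,2) by (simp add: n_subsets)
  finally have num: "card (?S \<inter> {c. v \<in> c}) = (card V - 1) choose (k - 1)" .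
  \<comment> \<open>Absorption identity: it turns the ratio of the two binomial coefficients into
    \<open>k / card V\<close>.\<close>
  have "k * (card V choose k) = card V * ((card V - 1) choose (k - 1))"
    using assms(3) by (simp add: times_binomial_minus1_eq)
  then have absorb: "real k * real (card V choose k) =
      real (card V) * real ((card V - 1) choose (k - 1))"
    by (metis of_nat_mult)
  have "measure_pmf.expectation (pmf_of_set ?S) (\<lambda>c. of_bool (v \<in> c)) =
      (\<Sum>c\<in>?S. of_bool (v \<in> c)) / real (card ?S)"
    using fin ne by (simp add: integral_pmf_of_set)
  also have "(\<Sum>c\<in>?S. of_bool (v \<in> c)) = real (card (?S \<inter> {c. v \<in> c}))"
    using fin by (subst sum_of_bool_eq) (simp_all add: Int_def)
  also have "\<dots> / real (card ?S) = real k / real (card V)"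
    using absorb pos assms(3,4) unfolding num cardS by (simp add: field_simps)
  finally show ?thesis .
qed

lemma expectation_cooc_degree:
  assumes "finite V" "v \<in> V"
  shows "measure_pmf.expectation (cooc_family_pmf m V \<gamma>) (\<lambda>c. real (cooc_degree m c v)) =
    real m / real (card V) * (size_norm (card V) \<gamma> * (\<Sum>k=1..card V. real k powr (1 - \<gamma>)))"
proof -
  have ne: "V \<noteq> {}" using assms(2) by auto
  \<comment> \<open>Writing the degree as a sum of indicators brings it into the form handled by
    linearity.\<close>
  have "real (cooc_degree m c v) = (\<Sum>i<m. of_bool (v \<in> c i))" for c
    unfolding cooc_degree_def by (subst sum_of_bool_eq) (simp_all add: Int_def)
  then have "measure_pmf.expectation (cooc_family_pmf m V \<gamma>) (\<lambda>c. real (cooc_degree m c v)) =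
      real m * measure_pmf.expectation (cooc_set_pmf V \<gamma>) (\<lambda>c. of_bool (v \<in> c))"
    by (simp only: expectation_cooc_family_sum[OF assms(1) ne, where g = "\<lambda>c. of_bool (v \<in> c)"])
  also have "\<dots> = real m *
      (\<Sum>k=1..card V. size_norm (card V) \<gamma> * real k powr (-\<gamma>) * (real k / real (card V)))"
    by (simp only: expectation_cooc_set_pmf[OF assms(1) ne prob_mem_uniform_subset[OF assms]])
  \<comment> \<open>The membership probability contributes a factor \<open>k\<close>, raising the
    exponent from \<open>-\<gamma>\<close> to \<open>1 - \<gamma>\<close>.\<close>
  also have "(\<Sum>k=1..card V. size_norm (card V) \<gamma> * real k powr (-\<gamma>) * (real k / real (card V))) =
      (\<Sum>k=1..card V. size_norm (card V) \<gamma> / real (card V) * real k powr (1 - \<gamma>))"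
    by (intro sum.cong) (auto simp: powr_diff powr_minus field_simps)
  finally show ?thesis by (simp add: sum_distrib_left)
qed

lemma expectation_cooc_sum_squares:
  assumes "finite V" "V \<noteq> {}"
  shows "measure_pmf.expectation (cooc_family_pmf m V \<gamma>) (\<lambda>c. \<Sum>i<m. real (card (c i)) ^ 2) =
    real m * (size_norm (card V) \<gamma> * (\<Sum>k=1..card V. real k powr (2 - \<gamma>)))"
proof -
  \<comment> \<open>Given the size, the squared cardinality is constant on the support.\<close>
  have "measure_pmf.expectation (pmf_of_set {c. c \<subseteq> V \<and> card c = k}) (\<lambda>c. real (card c) ^ 2) =
      real k ^ 2" if "k \<le> card V" for k
  proof -
    let ?S = "{c. c \<subseteq> V \<and> card c = k}"
    have "?S \<noteq> {}" using obtain_subset_with_card_n[OF that] by blast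
    moreover have "finite ?S" using assms(1) by simp
    ultimately show ?thesis by (simp add: integral_pmf_of_set)
  qed
  then have "measure_pmf.expectation (cooc_set_pmf V \<gamma>) (\<lambda>c. real (card c) ^ 2) =
      (\<Sum>k=1..card V. size_norm (card V) \<gamma> * real k powr (-\<gamma>) * real k ^ 2)"
    by (intro expectation_cooc_set_pmf[OF assms])
  also have "\<dots> = (\<Sum>k=1..card V. size_norm (card V) \<gamma> * real k powr (2 - \<gamma>))"
    by (intro sum.cong) (auto simp: powr_diff powr_minus field_simps)
  finally show ?thesis
    using expectation_cooc_family_sum[OF assms, of m \<gamma> "\<lambda>c. real (card c) ^ 2"]
    by (simp add: sum_distrib_left)
qed

theorem theorem11:
  fixes \<gamma> :: real and V :: "nat \<Rightarrow> 'a set" and m :: "nat \<Rightarrow> nat"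
  assumes "2 < \<gamma>" "\<gamma> < 3"
    and "\<And>n. finite (V n)" "\<And>n. card (V n) = n"
    and "(\<lambda>n. real (m n)) \<in> O(\<lambda>n. real n)"
  shows "(\<exists>B. \<forall>\<^sub>F n in sequentially. \<forall>v\<in>V n.
            measure_pmf.expectation (cooc_family_pmf (m n) (V n) \<gamma>)
              (\<lambda>c. real (cooc_degree (m n) c v)) \<le> B)
       \<and> (\<lambda>n. measure_pmf.expectation (cooc_family_pmf (m n) (V n) \<gamma>)
              (\<lambda>c. \<Sum>i<m n. real (card (c i)) ^ 2))
           \<in> O(\<lambda>n. real n powr (4 - \<gamma>))"
proof -
  obtain D where D: "D > 0" "\<forall>\<^sub>F n in sequentially. real (m n) \<le> D * real n"
    using assms(5) by (auto elim: landau_o.bigE)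
  have ev: "\<forall>\<^sub>F n in sequentially. n \<ge> 1 \<and> real (m n) \<le> D * real n"
    using D(2) eventually_ge_at_top[of 1] by eventually_elim auto
  \<comment> \<open>The series converges since \<open>1 - \<gamma> < -1\<close>; its term at
    \<open>k = 0\<close> is 0 because \<open>0 powr x = 0\<close>.\<close>
  define S where "S = (\<Sum>k. real k powr (1 - \<gamma>))"
  have S: "(\<Sum>k=1..n. real k powr (1 - \<gamma>)) \<le> S" for n
    unfolding S_def using assms(1) by (intro sum_le_suminf) (auto simp: summable_real_powr_iff)
  have degree: "\<forall>\<^sub>F n in sequentially. \<forall>v\<in>V n.
      measure_pmf.expectation (cooc_family_pmf (m n) (V n) \<gamma>)
        (\<lambda>c. real (cooc_degree (m n) c v)) \<le> D * (1 * S)"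
    using ev
  proof eventually_elim
    case (elim n)
    show ?case
    proof
      fix v assume v: "v \<in> V n"
      \<comment> \<open>The bound is kept as three factors, for \<open>m n / n\<close>, the
        normalizing constant and the sum, so that \<open>mult_mono\<close> compares them one by one.
        It does not depend on \<open>v\<close>.\<close>
      have "real (m n) / real n * (size_norm n \<gamma> * (\<Sum>k=1..n. real k powr (1 - \<gamma>))) \<le> D * (1 * S)"
        using elim D(1) S[of n]
        by (intro mult_mono mult_nonneg_nonneg sum_nonneg size_norm_le_1 size_norm_nonneg)
           (auto simp: field_simps)
      then show "measure_pmf.expectation (cooc_family_pmf (m n) (V n) \<gamma>)
          (\<lambda>c. real (cooc_degree (m n) c v)) \<le> D * (1 * S)"
        by (simp only: expectation_cooc_degree[OF assms(3) v] assms(4))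
    qed
  qed
  have "\<forall>\<^sub>F n in sequentially.
      norm (measure_pmf.expectation (cooc_family_pmf (m n) (V n) \<gamma>)
        (\<lambda>c. \<Sum>i<m n. real (card (c i)) ^ 2)) \<le> D / (3 - \<gamma>) * norm (real n powr (4 - \<gamma>))"
    using ev
  proof eventually_elim
    case (elim n)
    let ?E = "measure_pmf.expectation (cooc_family_pmf (m n) (V n) \<gamma>)
        (\<lambda>c. \<Sum>i<m n. real (card (c i)) ^ 2)"
    have ne: "V n \<noteq> {}" using elim assms(4)[of n] by auto
    have "?E = real (m n) * (size_norm n \<gamma> * (\<Sum>k=1..n. real k powr (2 - \<gamma>)))"
      by (simp only: expectation_cooc_sum_squares[OF assms(3) ne] assms(4))
    \<comment> \<open>Here \<open>sum_powr_le\<close> is used with \<open>p = 3 - \<gamma>\<close>,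
      which lies strictly between 0 and 1. The remaining factor \<open>n\<close> comes from the
      number of sets and lifts the exponent to \<open>4 - \<gamma>\<close>.\<close>
    also have "\<dots> \<le> (D * real n) * (1 * (real n powr (3 - \<gamma>) / (3 - \<gamma>)))"
      using elim D(1) sum_powr_le[of "3 - \<gamma>" n] assms(1,2)
      by (intro mult_mono mult_nonneg_nonneg sum_nonneg size_norm_le_1 size_norm_nonneg) auto
    also have "\<dots> = D / (3 - \<gamma>) * real n powr (4 - \<gamma>)"
    proof -
      have "real n powr (1 + (3 - \<gamma>)) = real n * real n powr (3 - \<gamma>)"
        using elim by (subst powr_add) auto
      then show ?thesis by simp
    qed
    finally have "?E \<le> D / (3 - \<gamma>) * real n powr (4 - \<gamma>)" .
    moreover have "?E \<ge> 0" by (intro Bochner_Integration.integral_nonneg sum_nonneg) auto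
    ultimately show ?case by simp
  qed
  then have "(\<lambda>n. measure_pmf.expectation (cooc_family_pmf (m n) (V n) \<gamma>)
        (\<lambda>c. \<Sum>i<m n. real (card (c i)) ^ 2)) \<in> O(\<lambda>n. real n powr (4 - \<gamma>))"
    by (rule landau_o.bigI[rotated]) (use D(1) assms(2) in simp)
  with degree show ?thesis by blast
qed

end
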